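(* Fix a tree partition of $\omega$. The forcing notion $\mathbb Q_{\mathcal H}=(\mathcal H^+,\le_{\mathcal H})$ is $\sigma$-closed (every descending sequence $X_0\ge_{\mathcal H}X_1\ge_{\mathcal H}\cdots$ in it has a lower bound in it); hence it is proper, its Boolean completion is $\omega$-distributive, and it adds no reals.
   Context: A tree partition of $\omega$ is a family $\langle A_s:s\in\omega^{<\omega}\rangle$ of infinite subsets of $\omega$ such that $A_\varnothing=\omega$, for each $s$ the family $\{A_{s^\frown n}:n\in\omega\}$ is a partition of $A_s$, and any two distinct points of $\omega$ lie in different cells $A_s\neq A_t$ with $|s|=|t|=n$ for some $n$. For $X\subseteq\omega$ let $T^\infty_X=\{s\in\omega^{<\omega}:X\cap A_s\text{ is infinite}\}$. For $T\subseteq\omega^{<\omega}$ put $\mathrm{Succ}_T(s)=\{n:s^\frown n\in T\}$ and $D(T)=\{s\in T:\mathrm{Succ}_T(s)\text{ is infinite}\}$; $D^0(T)=T$, $D^{\alpha+1}(T)=D(D^\alpha(T))$, $D^\lambda(T)=\bigcap_{\beta<\lambda}D^\beta(T)$ for limit $\lambda$. $\mathcal H=\bigcup_{\alpha<\omega_1}\{X\subseteq\omega:\varnothing\notin D^\alpha(T^\infty_X)\}$, a proper ideal on $\omega$. $\mathcal H^+=\mathcal P(\omega)\setminus\mathcal H$, and $X\le_{\mathcal H}Y\iff X\setminus Y\in\mathcal H$. *)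

theory Defs
  imports Main "HOL-Library.Countable_Set" "HOL-Library.Disjoint_Sets" "HOL-Algebra.Complete_Lattice"
begin

unbundle cardinal_syntax

section \<open>The ordinal \<open>\<omega>\<^sub>1\<close>\<close>

text \<open>
  \<open>cardSuc natLeq\<close> is a well-order of least uncountable order type, so the type below
  consists of exactly the ordinals \<open>\<alpha> < \<omega>\<^sub>1\<close>.
\<close>

typedef omega1 = "Field (cardSuc natLeq)"
proof -
  have "infinite (Field (cardSuc natLeq))"
    using natLeq_Card_order natLeq_cinfinite unfolding cinfinite_def
    by (meson cardSuc_finite)
  then have "Field (cardSuc natLeq) \<noteq> {}" by (metis finite.emptyI)
  then show "\<exists>x. x \<in> Field (cardSuc natLeq)" by (simp only: ex_in_conv not_False_eq_True)
qed

lemma Well_order_cardSuc_natLeq: "Well_order (cardSuc natLeq)"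
  using cardSuc_Card_order[OF natLeq_Card_order] card_order_on_well_order_on by blast

lemma wo_rel_cardSuc_natLeq: "wo_rel (cardSuc natLeq)"
  by (simp add: wo_rel_def Well_order_cardSuc_natLeq)

instantiation omega1 :: linorder
begin

definition less_eq_omega1 :: "omega1 \<Rightarrow> omega1 \<Rightarrow> bool"
  where "less_eq_omega1 \<alpha> \<beta> \<longleftrightarrow> (Rep_omega1 \<alpha>, Rep_omega1 \<beta>) \<in> cardSuc natLeq"

definition less_omega1 :: "omega1 \<Rightarrow> omega1 \<Rightarrow> bool"
  where "less_omega1 \<alpha> \<beta> \<longleftrightarrow> \<alpha> \<le> \<beta> \<and> \<alpha> \<noteq> \<beta>"

instance
proof
  note wo = wo_rel_cardSuc_natLeq
  fix x y z :: omega1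
  show refl: "x \<le> x"
    using wo_rel.REFL[OF wo] Rep_omega1[of x] by (auto simp: less_eq_omega1_def refl_on_def)
  show "x \<le> y \<Longrightarrow> y \<le> z \<Longrightarrow> x \<le> z"
    using wo_rel.TRANS[OF wo] by (auto simp: less_eq_omega1_def trans_def)
  show anti: "x \<le> y \<Longrightarrow> y \<le> x \<Longrightarrow> x = y"
    using wo_rel.ANTISYM[OF wo] by (auto simp: less_eq_omega1_def antisym_def intro: Rep_omega1_inject[THEN iffD1])
  show "x \<le> y \<or> y \<le> x"
    using wo_rel.TOTALS[OF wo] Rep_omega1[of x] Rep_omega1[of y]
    by (auto simp: less_eq_omega1_def)
  show "x < y \<longleftrightarrow> x \<le> y \<and> \<not> y \<le> x"
    using anti refl by (auto simp: less_omega1_def)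
qed

end

instance omega1 :: wellorder
proof
  fix P :: "omega1 \<Rightarrow> bool" and a
  assume step: "\<And>x. (\<And>y. y < x \<Longrightarrow> P y) \<Longrightarrow> P x"
  have "wf (inv_image (cardSuc natLeq - Id) Rep_omega1)"
    using wo_rel.WF[OF wo_rel_cardSuc_natLeq] by (rule wf_inv_image)
  then show "P a"
  proof (induction a rule: wf_induct_rule)
    case (less x)
    show ?case
      by (rule step, rule less)
        (auto simp: less_omega1_def less_eq_omega1_def Rep_omega1_inject)
  qed
qed


section \<open>Tree partitions and the derivative\<close>

text \<open>Elements of \<open>\<omega>\<^bsup><\<omega>\<^esup>\<close> are lists, and \<open>s\<^sup>\<frown>n\<close> is \<open>s @ [n]\<close>.\<close>

definition tree_partition :: "(nat list \<Rightarrow> nat set) \<Rightarrow> bool" where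
  "tree_partition A \<longleftrightarrow>
     (\<forall>s. infinite (A s)) \<and>
     A [] = UNIV \<and>
     (\<forall>s. disjoint_family (\<lambda>n. A (s @ [n])) \<and> (\<Union>n. A (s @ [n])) = A s) \<and>
     (\<forall>x y. x \<noteq> y \<longrightarrow> (\<exists>s t. length s = length t \<and> A s \<noteq> A t \<and> x \<in> A s \<and> y \<in> A t))"

definition T_inf :: "(nat list \<Rightarrow> nat set) \<Rightarrow> nat set \<Rightarrow> nat list set" where
  "T_inf A X = {s. infinite (X \<inter> A s)}"

definition Succ_tree :: "nat list set \<Rightarrow> nat list \<Rightarrow> nat set" where
  "Succ_tree T s = {n. s @ [n] \<in> T}"

definition D_op :: "nat list set \<Rightarrow> nat list set" where
  "D_op T = {s \<in> T. infinite (Succ_tree T s)}"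

text \<open>\<open>is_succ \<alpha> \<beta>\<close> says that \<open>\<alpha> = \<beta> + 1\<close>.\<close>

definition is_succ :: "'o::wellorder \<Rightarrow> 'o \<Rightarrow> bool" where
  "is_succ \<alpha> \<beta> \<longleftrightarrow> \<beta> < \<alpha> \<and> (\<forall>\<gamma><\<alpha>. \<gamma> \<le> \<beta>)"

lemma is_succ_unique: "is_succ \<alpha> \<beta> \<Longrightarrow> is_succ \<alpha> \<beta>' \<Longrightarrow> \<beta> = \<beta>'"
  unfolding is_succ_def by (meson order_antisym)

text \<open>
  The iterates \<open>D\<^sup>\<alpha>(T)\<close>, by recursion on \<open>\<alpha>\<close>; the three defining clauses are recovered
  as lemmas right after the termination proof.
\<close>

function D_iter :: "nat list set \<Rightarrow> 'o::wellorder \<Rightarrow> nat list set" where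
  "D_iter T \<alpha> =
     (if \<forall>\<beta>. \<alpha> \<le> \<beta> then T
      else if \<exists>\<beta>. is_succ \<alpha> \<beta>
        then D_op (D_iter T (THE \<beta>. is_succ \<alpha> \<beta>))
      else (\<Inter>\<beta>\<in>{..<\<alpha>}. D_iter T \<beta>))"
  by auto
termination
proof (relation "{((T :: nat list set, \<beta>), (T' :: nat list set, \<alpha> :: 'o::wellorder)). \<beta> < \<alpha>}")
  have "wf (inv_image {(\<beta>, \<alpha>). \<beta> < (\<alpha>::'o::wellorder)} (snd :: nat list set \<times> 'o \<Rightarrow> 'o))"
    by (intro wf_inv_image wf)
  then show "wf {((T :: nat list set, \<beta>), (T' :: nat list set, \<alpha>::'o::wellorder)). \<beta> < \<alpha>}"
    by (rule wf_subset) auto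
next
  fix T :: "nat list set" and \<alpha> :: "'o::wellorder"
  assume "\<exists>\<beta>. is_succ \<alpha> \<beta>"
  then have "is_succ \<alpha> (THE \<beta>. is_succ \<alpha> \<beta>)"
    by (metis is_succ_unique theI)
  then show "((T, THE \<beta>. is_succ \<alpha> \<beta>), (T, \<alpha>)) \<in> {((T, \<beta>), (T', \<alpha>)). \<beta> < \<alpha>}"
    by (simp add: is_succ_def)
qed auto

declare D_iter.simps [simp del]

lemma D_iter_zero:
  assumes "\<And>\<beta>. \<alpha> \<le> \<beta>"
  shows "D_iter T \<alpha> = T"
  using assms by (simp add: D_iter.simps)

lemma D_iter_succ:
  assumes "is_succ \<alpha> \<beta>"
  shows "D_iter T \<alpha> = D_op (D_iter T \<beta>)"
proof -
  have "(THE \<gamma>. is_succ \<alpha> \<gamma>) = \<beta>"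
    using assms is_succ_unique by blast
  moreover have "\<not> (\<forall>\<beta>. \<alpha> \<le> \<beta>)"
    using assms by (auto simp: is_succ_def not_le)
  ultimately show ?thesis
    using assms by (subst D_iter.simps) auto
qed

lemma D_iter_limit:
  assumes "\<not> (\<forall>\<beta>. \<alpha> \<le> \<beta>)" and "\<nexists>\<beta>. is_succ \<alpha> \<beta>"
  shows "D_iter T \<alpha> = (\<Inter>\<beta>\<in>{..<\<alpha>}. D_iter T \<beta>)"
  by (subst D_iter.simps) (simp only: assms if_False)


section \<open>The ideal and the order\<close>

definition ideal_H :: "(nat list \<Rightarrow> nat set) \<Rightarrow> nat set set" where
  "ideal_H A = (\<Union>\<alpha>::omega1. {X. [] \<notin> D_iter (T_inf A X) \<alpha>})"

definition H_plus :: "(nat list \<Rightarrow> nat set) \<Rightarrow> nat set set" where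
  "H_plus A = UNIV - ideal_H A"

definition le_H :: "(nat list \<Rightarrow> nat set) \<Rightarrow> nat set \<Rightarrow> nat set \<Rightarrow> bool" where
  "le_H A X Y \<longleftrightarrow> X - Y \<in> ideal_H A"


section \<open>Forcing notions\<close>

text \<open>
  A forcing notion is a carrier \<open>P\<close> with a preorder \<open>leq\<close> on it, \<open>leq q p\<close> meaning that \<open>q\<close>
  is stronger than \<open>p\<close>. The values of \<open>leq\<close> outside \<open>P\<close> never matter.
\<close>

definition sigma_closed :: "'p set \<Rightarrow> ('p \<Rightarrow> 'p \<Rightarrow> bool) \<Rightarrow> bool" where
  "sigma_closed P leq \<longleftrightarrow>
     (\<forall>X :: nat \<Rightarrow> 'p. (\<forall>n. X n \<in> P) \<and> (\<forall>n. leq (X (Suc n)) (X n)) \<longrightarrow>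
        (\<exists>Y\<in>P. \<forall>n. leq Y (X n)))"

definition compatible :: "'p set \<Rightarrow> ('p \<Rightarrow> 'p \<Rightarrow> bool) \<Rightarrow> 'p \<Rightarrow> 'p \<Rightarrow> bool" where
  "compatible P leq p q \<longleftrightarrow> (\<exists>r\<in>P. leq r p \<and> leq r q)"

definition dense_in :: "'p set \<Rightarrow> ('p \<Rightarrow> 'p \<Rightarrow> bool) \<Rightarrow> 'p set \<Rightarrow> bool" where
  "dense_in P leq D \<longleftrightarrow> D \<subseteq> P \<and> (\<forall>p\<in>P. \<exists>d\<in>D. leq d p)"

definition predense_below :: "'p set \<Rightarrow> ('p \<Rightarrow> 'p \<Rightarrow> bool) \<Rightarrow> 'p \<Rightarrow> 'p set \<Rightarrow> bool" where
  "predense_below P leq q D \<longleftrightarrow> (\<forall>r\<in>P. leq r q \<longrightarrow> (\<exists>d\<in>D. compatible P leq r d))"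


subsection \<open>Adding no reals\<close>

text \<open>
  A set \<open>\<tau> \<subseteq> P \<times> \<omega>\<close> is a name for the subset \<open>{n. \<exists>p\<in>G. (p, n) \<in> \<tau>}\<close> of \<open>\<omega>\<close> in the
  extension by a generic filter \<open>G\<close>, and every subset of \<open>\<omega>\<close> in the extension has such a
  name. The next two definitions are the forcing relation for the statements
  ``\<open>n \<in> \<tau>\<close>'' and ``\<open>\<tau> = a\<close>'' with \<open>a\<close> a ground model set.
\<close>

definition forces_mem :: "'p set \<Rightarrow> ('p \<Rightarrow> 'p \<Rightarrow> bool) \<Rightarrow> 'p \<Rightarrow> nat \<Rightarrow> ('p \<times> nat) set \<Rightarrow> bool" where
  "forces_mem P leq p n \<tau> \<longleftrightarrow>
     (\<forall>q\<in>P. leq q p \<longrightarrow> (\<exists>r\<in>P. leq r q \<and> (\<exists>s. (s, n) \<in> \<tau> \<and> leq r s)))"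

definition forces_eq_ground :: "'p set \<Rightarrow> ('p \<Rightarrow> 'p \<Rightarrow> bool) \<Rightarrow> 'p \<Rightarrow> ('p \<times> nat) set \<Rightarrow> nat set \<Rightarrow> bool" where
  "forces_eq_ground P leq p \<tau> a \<longleftrightarrow>
     (\<forall>n\<in>a. forces_mem P leq p n \<tau>) \<and>
     (\<forall>n. n \<notin> a \<longrightarrow> \<not> (\<exists>q\<in>P. leq q p \<and> forces_mem P leq q n \<tau>))"

text \<open>Every condition forces that every subset of \<open>\<omega>\<close> in the extension is in the ground model.\<close>

definition adds_no_reals :: "'p set \<Rightarrow> ('p \<Rightarrow> 'p \<Rightarrow> bool) \<Rightarrow> bool" where
  "adds_no_reals P leq \<longleftrightarrow>
     (\<forall>\<tau> \<subseteq> P \<times> UNIV. \<forall>p\<in>P. \<exists>q\<in>P. leq q p \<and> (\<exists>a. forces_eq_ground P leq q \<tau> a))"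


subsection \<open>Boolean completion and distributivity\<close>

text \<open>
  Open sets are the downward closed subsets of \<open>P\<close>; \<open>int_closure P leq U\<close> is the interior
  of the closure of \<open>U\<close> in this topology. The Boolean completion is the algebra
  of regular open sets, ordered by inclusion. As \<open>P\<close> need not be separative, the canonical
  map \<open>p \<mapsto> int_closure P leq {q \<in> P. leq q p}\<close> need not be injective.
\<close>

definition int_closure :: "'p set \<Rightarrow> ('p \<Rightarrow> 'p \<Rightarrow> bool) \<Rightarrow> 'p set \<Rightarrow> 'p set" where
  "int_closure P leq U = {p \<in> P. \<forall>q\<in>P. leq q p \<longrightarrow> (\<exists>r\<in>U. leq r q)}"

definition regular_open :: "'p set \<Rightarrow> ('p \<Rightarrow> 'p \<Rightarrow> bool) \<Rightarrow> 'p set \<Rightarrow> bool" where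
  "regular_open P leq U \<longleftrightarrow>
     U \<subseteq> P \<and> (\<forall>p\<in>U. \<forall>q\<in>P. leq q p \<longrightarrow> q \<in> U) \<and> int_closure P leq U = U"

definition boolean_completion :: "'p set \<Rightarrow> ('p \<Rightarrow> 'p \<Rightarrow> bool) \<Rightarrow> 'p set gorder" where
  "boolean_completion P leq =
     \<lparr>carrier = {U. regular_open P leq U}, eq = (=), le = (\<subseteq>)\<rparr>"

lemma regular_open_Inter:
  assumes reg: "\<And>U. U \<in> \<U> \<Longrightarrow> regular_open P leq U" and refl: "\<And>p. p \<in> P \<Longrightarrow> leq p p"
  shows "regular_open P leq (P \<inter> \<Inter>\<U>)"
  unfolding regular_open_def
proof (intro conjI ballI impI)
  show down: "q \<in> P \<inter> \<Inter>\<U>" if "p \<in> P \<inter> \<Inter>\<U>" "q \<in> P" "leq q p" for p q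
    using reg that unfolding regular_open_def by blast
  show "int_closure P leq (P \<inter> \<Inter>\<U>) = P \<inter> \<Inter>\<U>"
  proof
    show "int_closure P leq (P \<inter> \<Inter>\<U>) \<subseteq> P \<inter> \<Inter>\<U>"
    proof
      fix p assume p: "p \<in> int_closure P leq (P \<inter> \<Inter>\<U>)"
      have "p \<in> U" if U: "U \<in> \<U>" for U
      proof -
        have "p \<in> int_closure P leq U"
          using p U unfolding int_closure_def by blast
        then show ?thesis
          using reg[OF U] unfolding regular_open_def by blast
      qed
      then show "p \<in> P \<inter> \<Inter>\<U>"
        using p unfolding int_closure_def by blast
    qed
    show "P \<inter> \<Inter>\<U> \<subseteq> int_closure P leq (P \<inter> \<Inter>\<U>)"
      using down refl unfolding int_closure_def by blast
  qed
qed blast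

lemma boolean_completion_complete_lattice:
  assumes leq_refl: "\<And>p. p \<in> P \<Longrightarrow> leq p p"
  shows "complete_lattice (boolean_completion P leq)"
proof -
  let ?B = "boolean_completion P leq"
  interpret partial_order ?B
    by unfold_locales (auto simp: boolean_completion_def)
  have inf: "\<exists>i. greatest ?B i (Lower ?B \<U>)" if \<U>: "\<U> \<subseteq> carrier ?B" for \<U>
  proof -
    have "regular_open P leq (P \<inter> \<Inter>\<U>)"
      using \<U> by (intro regular_open_Inter) (auto simp: boolean_completion_def leq_refl)
    moreover have "\<forall>V\<in>\<U>. regular_open P leq V"
      using \<U> by (auto simp: boolean_completion_def)
    moreover have "V \<subseteq> P" if "regular_open P leq V" for V
      using that by (simp add: regular_open_def)
    ultimately have "greatest ?B (P \<inter> \<Inter>\<U>) (Lower ?B \<U>)"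
      unfolding greatest_def Lower_def boolean_completion_def by auto
    then show ?thesis ..
  qed
  have top: "\<exists>g. greatest ?B g (carrier ?B)"
    using inf[of "{}"] by (simp add: Lower_empty)
  show ?thesis
    by (rule complete_lattice_criterion1) (use top inf in auto)
qed

text \<open>
  The law \<open>\<Prod>\<^sub>n \<Sum>\<^sub>i u(n, i) = \<Sum>\<^sub>f \<Prod>\<^sub>n u(n, f(n))\<close>, where the family \<open>(u(n, i))\<^sub>i\<close> is given as the
  set \<open>U n\<close> of its members, of arbitrary cardinality.
\<close>

definition omega_distributive :: "'b gorder \<Rightarrow> bool" where
  "omega_distributive B \<longleftrightarrow>
     (\<forall>U :: nat \<Rightarrow> 'b set. (\<forall>n. U n \<subseteq> carrier B) \<longrightarrow>
        \<Sqinter>\<^bsub>B\<^esub>(range (\<lambda>n. \<Squnion>\<^bsub>B\<^esub>(U n))) =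
        \<Squnion>\<^bsub>B\<^esub>{\<Sqinter>\<^bsub>B\<^esub>(range f) | f. \<forall>n. f n \<in> U n})"


subsection \<open>Properness\<close>

text \<open>Formulas of set theory and the elementary submodel relation for substructures of \<open>('u, E)\<close>,
  where \<open>E x y\<close> is read ``\<open>x \<in> y\<close>''.\<close>

datatype fm = Mem nat nat | Eql nat nat | Neg fm | Conj fm fm | Ex nat fm

primrec sat :: "('u \<Rightarrow> 'u \<Rightarrow> bool) \<Rightarrow> 'u set \<Rightarrow> (nat \<Rightarrow> 'u) \<Rightarrow> fm \<Rightarrow> bool" where
  "sat E M v (Mem i j) \<longleftrightarrow> E (v i) (v j)"
| "sat E M v (Eql i j) \<longleftrightarrow> v i = v j"
| "sat E M v (Neg \<phi>) \<longleftrightarrow> \<not> sat E M v \<phi>"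
| "sat E M v (Conj \<phi> \<psi>) \<longleftrightarrow> sat E M v \<phi> \<and> sat E M v \<psi>"
| "sat E M v (Ex i \<phi>) \<longleftrightarrow> (\<exists>x\<in>M. sat E M (v(i := x)) \<phi>)"

definition elementary_submodel :: "('u \<Rightarrow> 'u \<Rightarrow> bool) \<Rightarrow> 'u set \<Rightarrow> bool" where
  "elementary_submodel E M \<longleftrightarrow>
     M \<noteq> {} \<and> (\<forall>\<phi> v. (\<forall>n. v n \<in> M) \<longrightarrow> (sat E M v \<phi> \<longleftrightarrow> sat E UNIV v \<phi>))"

text \<open>
  \<open>is_H \<theta> E\<close> says that \<open>\<theta>\<close> is a regular uncountable cardinal and that \<open>('u, E)\<close> is an isomorphic
  copy of \<open>(H(\<theta>), \<in>)\<close>: it is well-founded and extensional, and the subsets of \<open>'u\<close> that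
  are the extension of some element are exactly those with fewer than \<open>\<theta>\<close> members. By
  Mostowski collapse this determines \<open>('u, E)\<close> up to isomorphism. There is no loss in
  taking \<open>\<theta>\<close> as a cardinal on \<open>'u\<close>, as \<open>H(\<theta>)\<close> has at least \<open>\<theta>\<close> elements.
\<close>

definition is_H :: "'u rel \<Rightarrow> ('u \<Rightarrow> 'u \<Rightarrow> bool) \<Rightarrow> bool" where
  "is_H \<theta> E \<longleftrightarrow>
     Card_order \<theta> \<and> natLeq <o \<theta> \<and> regularCard \<theta> \<and>
     wfp E \<and>
     (\<forall>x y. (\<forall>z. E z x \<longleftrightarrow> E z y) \<longrightarrow> x = y) \<and>
     (\<forall>X. (\<exists>x. X = {z. E z x}) \<longleftrightarrow> |X| <o \<theta>)"

definition is_upair :: "('u \<Rightarrow> 'u \<Rightarrow> bool) \<Rightarrow> 'u \<Rightarrow> 'u \<Rightarrow> 'u \<Rightarrow> bool" where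
  "is_upair E u x y \<longleftrightarrow> (\<forall>w. E w u \<longleftrightarrow> w = x \<or> w = y)"

definition is_opair :: "('u \<Rightarrow> 'u \<Rightarrow> bool) \<Rightarrow> 'u \<Rightarrow> 'u \<Rightarrow> 'u \<Rightarrow> bool" where
  "is_opair E z x y \<longleftrightarrow> (\<exists>u w. is_upair E u x x \<and> is_upair E w x y \<and> is_upair E z u w)"

text \<open>
  The forcing notion as an element of \<open>H(\<theta>)\<close>: the injection \<open>c\<close> identifies conditions with
  elements of \<open>H(\<theta>)\<close>, and \<open>a\<close> and \<open>b\<close> are the resulting set of conditions and order relation.
\<close>

definition codes_forcing ::
    "('u \<Rightarrow> 'u \<Rightarrow> bool) \<Rightarrow> 'p set \<Rightarrow> ('p \<Rightarrow> 'p \<Rightarrow> bool) \<Rightarrow> ('p \<Rightarrow> 'u) \<Rightarrow> 'u \<Rightarrow> 'u \<Rightarrow> bool" where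
  "codes_forcing E P leq c a b \<longleftrightarrow>
     inj_on c P \<and>
     {z. E z a} = c ` P \<and>
     {z. E z b} = {z. \<exists>p\<in>P. \<exists>q\<in>P. leq p q \<and> is_opair E z (c p) (c q)}"

text \<open>\<open>q\<close> is \<open>(M, P)\<close>-generic: \<open>D \<inter> M\<close> is predense below \<open>q\<close> for every dense \<open>D \<subseteq> P\<close> with \<open>D \<in> M\<close>.\<close>

definition M_generic ::
    "('u \<Rightarrow> 'u \<Rightarrow> bool) \<Rightarrow> 'u set \<Rightarrow> 'p set \<Rightarrow> ('p \<Rightarrow> 'p \<Rightarrow> bool) \<Rightarrow> ('p \<Rightarrow> 'u) \<Rightarrow> 'p \<Rightarrow> bool" where
  "M_generic E M P leq c q \<longleftrightarrow>
     (\<forall>D d. dense_in P leq D \<and> d \<in> M \<and> {z. E z d} = c ` D \<longrightarrow>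
        predense_below P leq q {p \<in> D. c p \<in> M})"

text \<open>
  Properness: for every regular \<open>\<theta> > 2\<^bsup>|P|\<^esup>\<close> and every countable \<open>M \<prec> H(\<theta>)\<close> containing the
  forcing notion, every \<open>p \<in> P \<inter> M\<close> has an \<open>(M, P)\<close>-generic extension. A definition cannot
  quantify over types, so the type \<open>'u\<close> carrying \<open>H(\<theta>)\<close> is an argument; a theorem asserting
  properness should be polymorphic in it, so as to speak about all \<open>\<theta>\<close>.
\<close>

definition proper_forcing :: "'u itself \<Rightarrow> 'p set \<Rightarrow> ('p \<Rightarrow> 'p \<Rightarrow> bool) \<Rightarrow> bool" where
  "proper_forcing (_ :: 'u itself) P leq \<longleftrightarrow>
     (\<forall>(\<theta> :: 'u rel) E c a b M.
        is_H \<theta> E \<and> |Pow P| <o \<theta> \<and> codes_forcing E P leq c a b \<and>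
        countable M \<and> elementary_submodel E M \<and> a \<in> M \<and> b \<in> M \<longrightarrow>
        (\<forall>p\<in>P. c p \<in> M \<longrightarrow> (\<exists>q\<in>P. leq q p \<and> M_generic E M P leq c q)))"

end

theory Submission
  imports Defs "HOL-Library.Countable_Set_Type"
begin

text \<open>
  Why the theorem holds. A set \<open>X\<close> lies in \<open>\<H>\<close> iff its tree \<open>T\<^sup>\<infinity>\<^sub>X\<close> is ranked at the root
  by the following well-founded process: a node is ranked if it is off the tree or if all but
  finitely many of its successors are ranked (\<open>ideal_H_iff_ranked\<close>). The derivative computes
  this rank, and since suprema of countably many countable ordinals are countable, all ranks
  are below \<open>\<omega>\<^sub>1\<close>. Rank induction shows that \<open>\<H>\<close> is closed under finite unions
  (\<open>ranked_Un\<close>), so \<open>\<le>\<^sub>\<H>\<close> is a preorder.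

  No fusion is needed for \<open>\<sigma>\<close>-closure, because finitely many successors of the
  root never affect the rank. Given a sequence of positive sets, which may be taken decreasing
  under inclusion, the \<open>m\<close>-th set \<open>X\<^sub>m\<close> is still positive in infinitely many first-level cells;
  choose such a cell \<open>A\<^bsub>\<langle>k\<^sub>m\<rangle>\<^esub>\<close> with \<open>k\<^sub>m\<close> strictly increasing. The set
  \<open>Y = \<Union>\<^sub>m X\<^sub>m \<inter> A\<^bsub>\<langle>k\<^sub>m\<rangle>\<^esub>\<close> is positive in infinitely many cells, hence positive, while
  \<open>Y - X\<^sub>n\<close> meets only the finitely many cells \<open>A\<^bsub>\<langle>k\<^sub>m\<rangle>\<^esub>\<close> with \<open>m < n\<close>
  (\<open>le_H_lower_bound\<close>).

  The remaining clauses hold for every \<open>\<sigma>\<close>-closed preorder and are instances of one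
  principle: countably many requirements, each of which can be met below every condition, can be
  met simultaneously (\<open>meet_requirements\<close>). The requirements are to decide \<open>n \<in> \<tau>\<close>, to enter a
  member of \<open>U n\<close>, or to enter the \<open>n\<close>-th dense set of a countable \<open>M \<prec> H(\<theta>)\<close> while
  staying in \<open>M\<close>; for the last, elementarity keeps the witnesses in \<open>M\<close>.
\<close>

section \<open>Countable ordinals\<close>

lemma countable_atMost_omega1: "countable {..\<alpha> :: omega1}"
proof -
  have "|underS (cardSuc natLeq) (Rep_omega1 \<alpha>)| <o cardSuc natLeq"
    using card_of_underS[OF cardSuc_Card_order[OF natLeq_Card_order] Rep_omega1] .
  then have "|underS (cardSuc natLeq) (Rep_omega1 \<alpha>)| \<le>o natLeq"
    using cardSuc_ordLess_ordLeq[OF natLeq_Card_order card_of_Card_order]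
      cardSuc_ordLeq_ordLess[OF natLeq_Card_order card_of_Card_order] by blast
  then have "countable (underS (cardSuc natLeq) (Rep_omega1 \<alpha>))"
    by (simp add: countable_card_le_natLeq)
  moreover have "Rep_omega1 ` {..<\<alpha>} \<subseteq> underS (cardSuc natLeq) (Rep_omega1 \<alpha>)"
    by (auto simp: underS_def less_omega1_def less_eq_omega1_def Rep_omega1_inject)
  ultimately have "countable (Rep_omega1 ` {..<\<alpha>})"
    by (rule countable_subset[rotated])
  then have "countable {..<\<alpha>}"
    by (rule countable_image_inj_on) (simp add: inj_on_def Rep_omega1_inject)
  moreover have "{..\<alpha>} = insert \<alpha> {..<\<alpha>}"
    by auto
  ultimately show ?thesis
    by simp
qed

lemma uncountable_omega1: "\<not> countable (UNIV :: omega1 set)"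
proof
  assume "countable (UNIV :: omega1 set)"
  then have "countable (range Rep_omega1)"
    by (rule countable_image)
  then have "countable (Field (cardSuc natLeq))"
    by (simp add: type_definition.Rep_range[OF type_definition_omega1])
  then have "|Field (cardSuc natLeq)| \<le>o natLeq"
    by (simp add: countable_card_le_natLeq)
  then have "cardSuc natLeq \<le>o natLeq"
    using card_of_Field_ordIso[OF cardSuc_Card_order[OF natLeq_Card_order]]
      ordIso_symmetric ordIso_ordLeq_trans by blast
  then show False
    using cardSuc_greater[OF natLeq_Card_order] not_ordLess_ordLeq by blast
qed

lemma countable_omega1_strict_bound:
  fixes S :: "omega1 set"
  assumes "countable S"
  shows "\<exists>\<beta>. \<forall>\<alpha>\<in>S. \<alpha> < \<beta>"
proof -
  have "countable (\<Union>\<alpha>\<in>S. {..\<alpha>})"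
    using assms countable_atMost_omega1 by simp
  then have "(\<Union>\<alpha>\<in>S. {..\<alpha>}) \<noteq> UNIV"
    using uncountable_omega1 by metis
  then show ?thesis
    by (metis UNIV_eq_I UN_iff atMost_iff not_le)
qed

lemma omega1_successor_exists: "\<exists>\<beta>. is_succ \<beta> (\<alpha> :: omega1)"
proof -
  obtain \<gamma> where "\<alpha> < \<gamma>"
    using countable_omega1_strict_bound[of "{\<alpha>}"] by auto
  then have "\<alpha> < (LEAST \<beta>. \<alpha> < \<beta>)"
    by (rule LeastI)
  moreover have "\<delta> \<le> \<alpha>" if "\<delta> < (LEAST \<beta>. \<alpha> < \<beta>)" for \<delta>
    using not_less_Least[OF that] by simp
  ultimately show ?thesis
    by (auto simp: is_succ_def)
qed

section \<open>The rank of a node\<close>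

text \<open>
  The nodes removed at some stage of the iterated derivative. The exceptional set \<open>F\<close> in the
  second rule makes ``all but finitely many successors'' a positive condition, as an inductive
  definition requires.
\<close>

inductive ranked :: "nat list set \<Rightarrow> nat list \<Rightarrow> bool" for T where
  off_tree: "s \<notin> T \<Longrightarrow> ranked T s"
| almost_all_successors: "finite F \<Longrightarrow> (\<And>n. n \<notin> F \<Longrightarrow> ranked T (s @ [n])) \<Longrightarrow> ranked T s"

lemma ranked_if_finite_unranked:
  "finite {n. \<not> ranked T (s @ [n])} \<Longrightarrow> ranked T s"
  by (rule almost_all_successors) auto

lemma D_iter_decreasing:
  fixes \<alpha> \<beta> :: "'o::wellorder"
  shows "\<alpha> \<le> \<beta> \<Longrightarrow> D_iter T \<beta> \<subseteq> D_iter T \<alpha>"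
proof (induction \<beta> rule: less_induct)
  case (less \<beta>)
  consider "\<alpha> = \<beta>" | "\<alpha> < \<beta>" using less.prems by force
  then show ?case
  proof cases
    case 2
    show ?thesis
    proof (cases "\<exists>\<gamma>. is_succ \<beta> \<gamma>")
      case True
      then obtain \<gamma> where \<gamma>: "is_succ \<beta> \<gamma>" ..
      then have "D_iter T \<gamma> \<subseteq> D_iter T \<alpha>"
        using less.IH 2 by (simp add: is_succ_def)
      then show ?thesis
        using D_iter_succ[OF \<gamma>, of T] by (auto simp: D_op_def)
    next
      case False
      moreover have "\<not> (\<forall>\<gamma>. \<beta> \<le> \<gamma>)" using 2 by (metis not_le)
      ultimately show ?thesis using 2 by (auto simp: D_iter_limit)
    qed
  qed simp
qed

lemma unranked_in_D_iter:
  assumes "\<not> ranked T s"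
  shows "s \<in> D_iter T (\<alpha> :: 'o::wellorder)"
  using assms
proof (induction \<alpha> arbitrary: s rule: less_induct)
  case (less \<alpha>)
  consider "\<forall>\<beta>. \<alpha> \<le> \<beta>" | \<beta> where "is_succ \<alpha> \<beta>" | "\<not> (\<forall>\<beta>. \<alpha> \<le> \<beta>)" "\<nexists>\<beta>. is_succ \<alpha> \<beta>"
    by blast
  then show ?case
  proof cases
    case 1
    then have "D_iter T \<alpha> = T" by (simp add: D_iter_zero)
    then show ?thesis using less.prems off_tree by blast
  next
    case (2 \<beta>)
    then have "\<beta> < \<alpha>" by (simp add: is_succ_def)
    have "infinite {n. \<not> ranked T (s @ [n])}"
      using less.prems ranked_if_finite_unranked by blast
    moreover have "{n. \<not> ranked T (s @ [n])} \<subseteq> Succ_tree (D_iter T \<beta>) s"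
      using less.IH[OF \<open>\<beta> < \<alpha>\<close>] by (auto simp: Succ_tree_def)
    ultimately have "infinite (Succ_tree (D_iter T \<beta>) s)"
      using finite_subset by blast
    then show ?thesis
      using less.IH[OF \<open>\<beta> < \<alpha>\<close> less.prems] by (simp add: D_iter_succ[OF 2] D_op_def)
  next
    case 3
    then show ?thesis using less by (auto simp: D_iter_limit)
  qed
qed

text \<open>
  The rank of a node is bounded in terms of the countably many ranks of its successors, and a
  countable set of countable ordinals is bounded below \<open>\<omega>\<^sub>1\<close>.
\<close>

lemma ranked_not_in_D_iter:
  assumes "ranked T s"
  shows "\<exists>\<alpha>::omega1. s \<notin> D_iter T \<alpha>"
  using assms
proof induction
  case (off_tree s)
  have "D_iter T (LEAST \<alpha>::omega1. True) = T"
    by (rule D_iter_zero) (simp add: Least_le)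
  then show ?case using off_tree by metis
next
  case (almost_all_successors F s)
  then obtain r :: "nat \<Rightarrow> omega1" where r: "\<And>n. n \<notin> F \<Longrightarrow> s @ [n] \<notin> D_iter T (r n)"
    by metis
  obtain \<beta> where \<beta>: "\<And>n. r n < \<beta>"
    using countable_omega1_strict_bound[of "range r"] by auto
  obtain \<alpha> where \<alpha>: "is_succ \<alpha> \<beta>"
    using omega1_successor_exists by blast
  have "Succ_tree (D_iter T \<beta>) s \<subseteq> F"
    using r D_iter_decreasing[OF less_imp_le[OF \<beta>], of T] by (auto simp: Succ_tree_def)
  then have "finite (Succ_tree (D_iter T \<beta>) s)"
    using almost_all_successors.hyps finite_subset by blast
  then have "s \<notin> D_iter T \<alpha>"
    by (simp add: D_iter_succ[OF \<alpha>] D_op_def)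
  then show ?case ..
qed

lemma ideal_H_iff_ranked: "X \<in> ideal_H A \<longleftrightarrow> ranked (T_inf A X) []"
proof -
  have "X \<in> ideal_H A \<longleftrightarrow> (\<exists>\<alpha>::omega1. [] \<notin> D_iter (T_inf A X) \<alpha>)"
    by (simp add: ideal_H_def)
  also have "\<dots> \<longleftrightarrow> ranked (T_inf A X) []"
    using unranked_in_D_iter[of "T_inf A X" "[]", where 'o = omega1]
      ranked_not_in_D_iter[of "T_inf A X" "[]"]
    by metis
  finally show ?thesis .
qed

text \<open>The rank of \<open>s\<close> depends only on the part of the tree above \<open>s\<close>.\<close>

lemma ranked_antimono_above:
  assumes "ranked T s" and "\<And>t. s @ t \<in> T' \<Longrightarrow> s @ t \<in> T"
  shows "ranked T' s"
  using assms
proof induction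
  case (off_tree s)
  have "s \<notin> T'" using off_tree(1) off_tree(2)[of "[]"] by auto
  then show ?case by (rule ranked.off_tree)
next
  case (almost_all_successors F s)
  have "ranked T' (s @ [n])" if "n \<notin> F" for n
  proof (rule almost_all_successors.IH[OF that])
    fix t assume "(s @ [n]) @ t \<in> T'"
    then show "(s @ [n]) @ t \<in> T"
      using almost_all_successors.prems[of "n # t"] by simp
  qed
  then show ?case using almost_all_successors.hyps(1) ranked.almost_all_successors by blast
qed

lemma finite_unranked_if_ranked:
  assumes "ranked T s" and "\<And>n. s @ [n] \<in> T \<Longrightarrow> s \<in> T"
  shows "finite {n. \<not> ranked T (s @ [n])}"
  using assms(1)
proof cases
  case off_tree
  then have "{n. \<not> ranked T (s @ [n])} = {}"
    using assms(2) ranked.off_tree by blast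
  then show ?thesis by simp
next
  case (almost_all_successors F)
  then have "{n. \<not> ranked T (s @ [n])} \<subseteq> F" by blast
  then show ?thesis using almost_all_successors(1) by (rule finite_subset)
qed

text \<open>
  While \<open>s\<close> is on both trees, both ranks drop at almost all successors simultaneously. Once one
  tree has been left, closure under initial segments prevents a return, and the other rank
  alone finishes the induction.
\<close>

lemma ranked_Un:
  assumes closed: "\<And>s n. s @ [n] \<in> T \<Longrightarrow> s \<in> T" "\<And>s n. s @ [n] \<in> T' \<Longrightarrow> s \<in> T'"
    and "ranked T s" "ranked T' s"
  shows "ranked (T \<union> T') s"
  using assms(3,4)
proof induction
  case (off_tree s)
  from off_tree(2,1) show ?case
  proof induction
    case (off_tree s)
    then show ?case by (auto intro: ranked.off_tree)
  next
    case (almost_all_successors F s)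
    then show ?case using closed(1) ranked.almost_all_successors by metis
  qed
next
  case (almost_all_successors F s)
  have "finite (F \<union> {n. \<not> ranked T' (s @ [n])})"
    using almost_all_successors.hyps(1) finite_unranked_if_ranked[OF almost_all_successors.prems] closed(2)
    by blast
  then show ?case
    by (rule ranked.almost_all_successors) (use almost_all_successors.IH in auto)
qed

section \<open>The ideal and its quotient order\<close>

lemma tree_partition_successor_subset:
  assumes "tree_partition A"
  shows "A (s @ [n]) \<subseteq> A s"
proof -
  have "(\<Union>n. A (s @ [n])) = A s"
    using assms by (simp add: tree_partition_def)
  then show ?thesis by blast
qed

lemma tree_partition_extension_subset:
  assumes "tree_partition A"
  shows "A (s @ t) \<subseteq> A s"
proof (induction t rule: rev_induct)
  case (snoc n t)
  then show ?case
    using tree_partition_successor_subset[OF assms, of "s @ t" n] by simp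
qed simp

lemma T_inf_initial_segment:
  assumes "tree_partition A" "s @ [n] \<in> T_inf A X"
  shows "s \<in> T_inf A X"
proof -
  have "X \<inter> A (s @ [n]) \<subseteq> X \<inter> A s"
    using tree_partition_successor_subset[OF assms(1)] by blast
  then show ?thesis
    using infinite_super[of "X \<inter> A (s @ [n])" "X \<inter> A s"] assms(2) by (simp add: T_inf_def)
qed

lemma T_inf_mono: "X \<subseteq> Y \<Longrightarrow> T_inf A X \<subseteq> T_inf A Y"
proof
  fix s assume "X \<subseteq> Y" "s \<in> T_inf A X"
  then show "s \<in> T_inf A Y"
    using infinite_super[of "X \<inter> A s" "Y \<inter> A s"] by (simp add: T_inf_def le_infI1)
qed

lemma T_inf_Un: "T_inf A (X \<union> Y) = T_inf A X \<union> T_inf A Y"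
  by (auto simp: T_inf_def Int_Un_distrib2)

lemma ideal_H_subset: "Y \<in> ideal_H A \<Longrightarrow> X \<subseteq> Y \<Longrightarrow> X \<in> ideal_H A"
  unfolding ideal_H_iff_ranked using T_inf_mono[of X Y A] by (auto intro: ranked_antimono_above)

lemma ideal_H_Un:
  assumes "tree_partition A" "X \<in> ideal_H A" "Y \<in> ideal_H A"
  shows "X \<union> Y \<in> ideal_H A"
  using assms(2,3) unfolding ideal_H_iff_ranked T_inf_Un
  by (intro ranked_Un) (use T_inf_initial_segment[OF assms(1)] in auto)

lemma empty_in_ideal_H: "{} \<in> ideal_H A"
  unfolding ideal_H_iff_ranked by (rule ranked.off_tree) (simp add: T_inf_def)

lemma le_H_refl: "le_H A X X"
  by (simp add: le_H_def empty_in_ideal_H)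

lemma le_H_trans:
  assumes "tree_partition A" "le_H A X Y" "le_H A Y Z"
  shows "le_H A X Z"
  using ideal_H_subset[OF ideal_H_Un[OF assms(1), of "X - Y" "Y - Z"], of "X - Z"] assms(2,3)
  unfolding le_H_def by blast

lemma infinite_unranked_first_level:
  assumes "X \<in> H_plus A"
  shows "infinite {n. \<not> ranked (T_inf A X) [n]}"
  using assms ranked_if_finite_unranked[of "T_inf A X" "[]"]
  by (auto simp: H_plus_def ideal_H_iff_ranked)

lemma in_ideal_H_if_meets_finitely_many_cells:
  assumes "finite F" and "\<And>n. n \<notin> F \<Longrightarrow> X \<inter> A [n] = {}"
  shows "X \<in> ideal_H A"
  unfolding ideal_H_iff_ranked
  by (rule ranked.almost_all_successors[OF assms(1)])
    (use assms(2) in \<open>auto simp: T_inf_def intro!: ranked.off_tree\<close>)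

text \<open>
  Diagonalization over the first level of the tree: cell \<open>k m\<close> is devoted to \<open>X m\<close>, where it
  inherits from \<open>X m\<close> an unranked node. The part of the union outside \<open>X n\<close> lives in the cells
  \<open>k m\<close> with \<open>m < n\<close>, too few to make the root unranked.
\<close>

lemma decseq_H_plus_lower_bound:
  fixes X :: "nat \<Rightarrow> nat set"
  assumes A: "tree_partition A" and X: "\<And>m. X m \<in> H_plus A"
    and dec: "\<And>m n. m \<le> n \<Longrightarrow> X n \<subseteq> X m"
  shows "\<exists>Y\<in>H_plus A. \<forall>n. le_H A Y (X n)"
proof -
  have pick: "\<exists>n>b. \<not> ranked (T_inf A (X m)) [n]" for m b
    using infinite_unranked_first_level[OF X] by (simp add: infinite_nat_iff_unbounded)
  have "\<exists>k::nat \<Rightarrow> nat. \<forall>m. \<not> ranked (T_inf A (X m)) [k m] \<and> k m < k (Suc m)"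
    by (rule dependent_nat_choice) (use pick in blast)+
  then obtain k :: "nat \<Rightarrow> nat"
    where k: "\<And>m. \<not> ranked (T_inf A (X m)) [k m]" and step: "\<And>m. k m < k (Suc m)"
    by blast
  have "inj k"
    using step by (simp add: strict_mono_Suc_iff strict_mono_imp_inj_on)
  define Y where "Y = (\<Union>m. X m \<inter> A [k m])"
  have "\<not> ranked (T_inf A Y) [k m]" for m
  proof
    assume "ranked (T_inf A Y) [k m]"
    moreover have "[k m] @ t \<in> T_inf A Y" if "[k m] @ t \<in> T_inf A (X m)" for t
    proof -
      have "X m \<inter> A ([k m] @ t) \<subseteq> Y \<inter> A ([k m] @ t)"
        using tree_partition_extension_subset[OF A, of "[k m]" t] by (auto simp: Y_def)
      then show ?thesis
        using that infinite_super unfolding T_inf_def mem_Collect_eq by metis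
    qed
    ultimately have "ranked (T_inf A (X m)) [k m]"
      by (rule ranked_antimono_above)
    with k show False ..
  qed
  then have "range k \<subseteq> {n. \<not> ranked (T_inf A Y) ([] @ [n])}"
    by auto
  then have "infinite {n. \<not> ranked (T_inf A Y) ([] @ [n])}"
    using range_inj_infinite[OF \<open>inj k\<close>] finite_subset by blast
  then have "Y \<in> H_plus A"
    using finite_unranked_if_ranked[of "T_inf A Y" "[]"] T_inf_initial_segment[OF A, of "[]"]
    by (auto simp: H_plus_def ideal_H_iff_ranked)
  moreover have "le_H A Y (X n)" for n
    unfolding le_H_def
  proof (rule in_ideal_H_if_meets_finitely_many_cells)
    show "finite (k ` {..<n})" by simp
    fix j assume j: "j \<notin> k ` {..<n}"
    have "disjoint_family (\<lambda>n. A ([] @ [n]))"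
      using A unfolding tree_partition_def by (elim conjE) (erule allE[of _ "[]"], erule conjE)
    then have disj: "disjoint_family (\<lambda>n. A [n])"
      by simp
    show "(Y - X n) \<inter> A [j] = {}"
    proof (rule equals0I)
      fix x assume x: "x \<in> (Y - X n) \<inter> A [j]"
      then obtain m where m: "x \<in> X m" "x \<in> A [k m]"
        by (auto simp: Y_def)
      with x disj have "j = k m"
        by (auto simp: disjoint_family_on_def)
      then have "n \<le> m"
        using j by (metis imageI lessThan_iff not_le)
      then show False
        using dec m x by blast
    qed
  qed
  ultimately show ?thesis by blast
qed

text \<open>
  Replacing \<open>X n\<close> by \<open>X 0 \<inter> \<dots> \<inter> X n\<close> removes only a set in \<open>\<H>\<close>, which reduces descending
  modulo \<open>\<H>\<close> to decreasing under inclusion.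
\<close>

lemma le_H_lower_bound:
  assumes A: "tree_partition A" and X: "\<And>n. X n \<in> H_plus A"
    and desc: "\<And>n. le_H A (X (Suc n)) (X n)"
  shows "\<exists>Y\<in>H_plus A. \<forall>n. le_H A Y (X n)"
proof -
  define Z where "Z n = (\<Inter>i\<le>n. X i)" for n
  have ZX: "X n - Z n \<in> ideal_H A" for n
  proof (induction n)
    case 0
    then show ?case by (simp add: Z_def empty_in_ideal_H)
  next
    case (Suc n)
    have "X (Suc n) - Z (Suc n) \<subseteq> (X (Suc n) - X n) \<union> (X n - Z n)"
      by (auto simp: Z_def atMost_Suc)
    moreover have "(X (Suc n) - X n) \<union> (X n - Z n) \<in> ideal_H A"
      using ideal_H_Un[OF A _ Suc] desc[of n] by (simp add: le_H_def)
    ultimately show ?case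
      by (rule ideal_H_subset[rotated])
  qed
  have "Z n \<in> H_plus A" for n
  proof (rule ccontr)
    assume "Z n \<notin> H_plus A"
    then have "Z n \<in> ideal_H A"
      by (simp add: H_plus_def)
    with ZX have "(X n - Z n) \<union> Z n \<in> ideal_H A"
      by (rule ideal_H_Un[OF A])
    then have "X n \<in> ideal_H A"
      by (rule ideal_H_subset) blast
    then show False
      using X by (simp add: H_plus_def)
  qed
  moreover have "Z n \<subseteq> Z m" if "m \<le> n" for m n
    unfolding Z_def using that by (intro INF_superset_mono) auto
  ultimately have "\<exists>Y\<in>H_plus A. \<forall>n. le_H A Y (Z n)"
    by (rule decseq_H_plus_lower_bound[OF A])
  then obtain Y where Y: "Y \<in> H_plus A" "\<And>n. le_H A Y (Z n)"
    by blast
  have "le_H A Y (X n)" for n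
  proof -
    have "Y - X n \<subseteq> Y - Z n"
      by (auto simp: Z_def)
    then show ?thesis
      using Y(2)[of n] unfolding le_H_def by (rule ideal_H_subset[rotated])
  qed
  with Y(1) show ?thesis by blast
qed

section \<open>Sigma-closed forcing notions\<close>

locale forcing_preorder =
  fixes P :: "'p set" and leq :: "'p \<Rightarrow> 'p \<Rightarrow> bool"
  assumes leq_refl: "p \<in> P \<Longrightarrow> leq p p"
    and leq_trans: "\<lbrakk>p \<in> P; q \<in> P; r \<in> P; leq p q; leq q r\<rbrakk> \<Longrightarrow> leq p r"

locale sigma_closed_forcing = forcing_preorder P leq
  for P :: "'p set" and leq :: "'p \<Rightarrow> 'p \<Rightarrow> bool" +
  assumes sigma_closed: "sigma_closed P leq"
begin

text \<open>
  The set \<open>Q\<close> confines the descending sequence, but not its lower bound: a sequence of conditions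
  from a countable model need not have a lower bound in that model.
\<close>

lemma meet_requirements:
  fixes R :: "nat \<Rightarrow> 'p \<Rightarrow> bool"
  assumes "Q \<subseteq> P" and "p \<in> Q"
    and dense: "\<And>n q. q \<in> Q \<Longrightarrow> \<exists>r\<in>Q. leq r q \<and> R n r"
  shows "\<exists>q\<in>P. leq q p \<and> (\<forall>n. \<exists>r\<in>Q. R n r \<and> leq q r)"
proof -
  have "\<exists>X. \<forall>n. (X n \<in> Q \<and> (n = 0 \<longrightarrow> X n = p)) \<and> (leq (X (Suc n)) (X n) \<and> R n (X (Suc n)))"
    by (rule dependent_nat_choice) (use \<open>p \<in> Q\<close> dense in blast)+
  then obtain X where X: "\<And>n. X n \<in> Q" "X 0 = p" "\<And>n. leq (X (Suc n)) (X n)" "\<And>n. R n (X (Suc n))"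
    by blast
  obtain q where "q \<in> P" "\<And>n. leq q (X n)"
    using sigma_closed X(1,3) \<open>Q \<subseteq> P\<close> unfolding sigma_closed_def by (meson subsetD)
  then show ?thesis using X by metis
qed

end

subsection \<open>Adding no reals\<close>

context forcing_preorder
begin

lemma forces_mem_stronger:
  assumes "forces_mem P leq p n \<tau>" "p \<in> P" "q \<in> P" "leq q p"
  shows "forces_mem P leq q n \<tau>"
  using assms leq_trans unfolding forces_mem_def by blast

end

context sigma_closed_forcing
begin

text \<open>
  The conditions deciding a given ``\<open>n \<in> \<tau>\<close>'' are dense, so below every condition some \<open>q\<close> decides
  all these statements at once, and the decisions of \<open>q\<close> are a ground model set.
\<close>

theorem sigma_closed_adds_no_reals: "adds_no_reals P leq"
  unfolding adds_no_reals_def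
proof (intro allI impI ballI)
  fix \<tau> p assume "p \<in> P"
  define R where "R n q \<longleftrightarrow> forces_mem P leq q n \<tau> \<or> \<not> (\<exists>r\<in>P. leq r q \<and> forces_mem P leq r n \<tau>)"
    for n q
  have "\<exists>r\<in>P. leq r q \<and> R n r" if "q \<in> P" for n q
    using that leq_refl unfolding R_def by blast
  then obtain q where q: "q \<in> P" "leq q p" and decides: "\<And>n. \<exists>r\<in>P. R n r \<and> leq q r"
    using meet_requirements[of P p R] \<open>p \<in> P\<close> by blast
  have "forces_eq_ground P leq q \<tau> {n. forces_mem P leq q n \<tau>}"
    unfolding forces_eq_ground_def
  proof (intro conjI allI impI ballI notI)
    fix n assume n: "n \<notin> {n. forces_mem P leq q n \<tau>}" and "\<exists>r\<in>P. leq r q \<and> forces_mem P leq r n \<tau>"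
    then obtain r where r: "r \<in> P" "leq r q" "forces_mem P leq r n \<tau>" by blast
    obtain r' where r': "r' \<in> P" "R n r'" "leq q r'" using decides by blast
    then have "leq r r'" using r q leq_trans by blast
    then have "forces_mem P leq r' n \<tau>" using r r' unfolding R_def by blast
    then show False using forces_mem_stronger n q r' by blast
  qed simp
  with q show "\<exists>q\<in>P. leq q p \<and> (\<exists>a. forces_eq_ground P leq q \<tau> a)" by blast
qed

end

subsection \<open>Distributivity of the completion\<close>

context forcing_preorder
begin

lemma int_closure_down:
  assumes "p \<in> int_closure P leq U" "q \<in> P" "leq q p"
  shows "q \<in> int_closure P leq U"
proof -
  have "\<exists>s\<in>U. leq s r" if "r \<in> P" "leq r q" for r
    using assms that leq_trans[of r q p] by (simp add: int_closure_def)
  then show ?thesis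
    using assms(2) by (simp add: int_closure_def)
qed

lemma int_closure_mono: "U \<subseteq> V \<Longrightarrow> int_closure P leq U \<subseteq> int_closure P leq V"
  by (fastforce simp: int_closure_def)

lemma open_subset_int_closure:
  assumes "U \<subseteq> P" and "\<And>p q. \<lbrakk>p \<in> U; q \<in> P; leq q p\<rbrakk> \<Longrightarrow> q \<in> U"
  shows "U \<subseteq> int_closure P leq U"
proof
  fix p assume "p \<in> U"
  moreover have "\<exists>r\<in>U. leq r q" if "q \<in> P" "leq q p" for q
    using assms(2)[OF \<open>p \<in> U\<close> that] leq_refl[OF that(1)] by (rule bexI[rotated])
  ultimately show "p \<in> int_closure P leq U"
    using assms(1) by (auto simp: int_closure_def)
qed

lemma regular_open_int_closure:
  assumes "U \<subseteq> P"
  shows "regular_open P leq (int_closure P leq U)"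
proof -
  have sub: "int_closure P leq U \<subseteq> P"
    by (auto simp: int_closure_def)
  have "int_closure P leq (int_closure P leq U) \<subseteq> int_closure P leq U"
  proof
    fix p assume p: "p \<in> int_closure P leq (int_closure P leq U)"
    have "\<exists>s\<in>U. leq s q" if q: "q \<in> P" "leq q p" for q
    proof -
      obtain r where r: "r \<in> int_closure P leq U" "leq r q"
        using p q by (auto simp: int_closure_def[of P leq "int_closure P leq U"])
      then have "r \<in> P" using sub by blast
      then obtain s where "s \<in> U" "leq s r"
        using r(1) leq_refl[of r] by (auto simp: int_closure_def)
      then show ?thesis
        using leq_trans[of s r q] r(2) q(1) \<open>r \<in> P\<close> \<open>U \<subseteq> P\<close> by blast
    qed
    then show "p \<in> int_closure P leq U"
      using p by (simp add: int_closure_def)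
  qed
  then show ?thesis
    using sub int_closure_down open_subset_int_closure[OF sub int_closure_down]
    unfolding regular_open_def by (intro conjI) (blast, blast, simp)
qed

lemma boolean_completion_sup:
  assumes "\<U> \<subseteq> carrier (boolean_completion P leq)"
  shows "\<Squnion>\<^bsub>boolean_completion P leq\<^esub>\<U> = int_closure P leq (\<Union>\<U>)"
proof -
  interpret B: complete_lattice "boolean_completion P leq"
    by (rule boolean_completion_complete_lattice) (rule leq_refl)
  have reg: "regular_open P leq U" if "U \<in> \<U>" for U
    using assms that by (auto simp: boolean_completion_def)
  have sub: "\<Union>\<U> \<subseteq> P"
    using reg unfolding regular_open_def by blast
  have closed: "regular_open P leq (int_closure P leq (\<Union>\<U>))"
    by (rule regular_open_int_closure[OF sub])
  have upper: "U \<subseteq> int_closure P leq (\<Union>\<U>)" if "U \<in> \<U>" for U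
  proof -
    have "U = int_closure P leq U"
      using reg[OF that] by (simp add: regular_open_def)
    also have "\<dots> \<subseteq> int_closure P leq (\<Union>\<U>)"
      using that by (intro int_closure_mono) blast
    finally show ?thesis .
  qed
  have least: "int_closure P leq (\<Union>\<U>) \<subseteq> V" if "regular_open P leq V" "\<And>U. U \<in> \<U> \<Longrightarrow> U \<subseteq> V" for V
  proof -
    have "int_closure P leq (\<Union>\<U>) \<subseteq> int_closure P leq V"
      using that(2) by (intro int_closure_mono Union_least)
    then show ?thesis
      using that(1) by (simp add: regular_open_def)
  qed
  have "least (boolean_completion P leq) (int_closure P leq (\<Union>\<U>))
      (Upper (boolean_completion P leq) \<U>)"
    unfolding least_def
  proof (intro conjI ballI)
    show "int_closure P leq (\<Union>\<U>) \<in> Upper (boolean_completion P leq) \<U>"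
      using closed upper by (simp add: Upper_def boolean_completion_def)
    fix V assume V: "V \<in> Upper (boolean_completion P leq) \<U>"
    have "regular_open P leq V"
      using V by (simp add: Upper_def boolean_completion_def)
    moreover have "U \<subseteq> V" if "U \<in> \<U>" for U
      using V that reg[OF that] by (simp add: Upper_def boolean_completion_def)
    ultimately show "int_closure P leq (\<Union>\<U>) \<sqsubseteq>\<^bsub>boolean_completion P leq\<^esub> V"
      using least[of V] by (simp add: boolean_completion_def)
  qed simp
  then show ?thesis
    using B.least_unique[OF _ B.sup_lub[OF assms]] by simp
qed

lemma boolean_completion_inf:
  assumes "\<U> \<subseteq> carrier (boolean_completion P leq)"
  shows "\<Sqinter>\<^bsub>boolean_completion P leq\<^esub>\<U> = P \<inter> \<Inter>\<U>"
proof -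
  interpret B: complete_lattice "boolean_completion P leq"
    by (rule boolean_completion_complete_lattice) (rule leq_refl)
  have reg: "regular_open P leq U" if "U \<in> \<U>" for U
    using assms that by (auto simp: boolean_completion_def)
  have closed: "regular_open P leq (P \<inter> \<Inter>\<U>)"
    by (rule regular_open_Inter) (rule reg, assumption, rule leq_refl)
  have "greatest (boolean_completion P leq) (P \<inter> \<Inter>\<U>) (Lower (boolean_completion P leq) \<U>)"
    unfolding greatest_def
  proof (intro conjI ballI)
    show "P \<inter> \<Inter>\<U> \<in> Lower (boolean_completion P leq) \<U>"
      using closed by (auto simp: Lower_def boolean_completion_def)
    fix V assume V: "V \<in> Lower (boolean_completion P leq) \<U>"
    have "V \<subseteq> P"
      using V by (simp add: Lower_def boolean_completion_def regular_open_def)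
    moreover have "V \<subseteq> U" if "U \<in> \<U>" for U
      using V that reg[OF that] by (simp add: Lower_def boolean_completion_def)
    ultimately have "V \<subseteq> P \<inter> \<Inter>\<U>"
      by (intro Int_greatest Inter_greatest)
    then show "V \<sqsubseteq>\<^bsub>boolean_completion P leq\<^esub> P \<inter> \<Inter>\<U>"
      by (simp add: boolean_completion_def)
  qed simp
  then show ?thesis
    using B.greatest_unique[OF _ B.inf_glb[OF assms]] by simp
qed

end

context sigma_closed_forcing
begin

text \<open>
  The inequality \<open>\<ge>\<close> is monotonicity; \<open>\<sigma>\<close>-closure gives \<open>\<le>\<close>. A condition \<open>p\<close> in the left-hand side lies in
  the interior of the closure of each \<open>\<Union>(U n)\<close>, so each \<open>\<Union>(U n)\<close> can be entered below every
  extension of \<open>p\<close>. A condition entering all of them picks a member of every \<open>U n\<close>, and these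
  choices form the function \<open>f\<close>.
\<close>

theorem sigma_closed_omega_distributive: "omega_distributive (boolean_completion P leq)"
  unfolding omega_distributive_def
proof (intro allI impI)
  let ?B = "boolean_completion P leq"
  fix U :: "nat \<Rightarrow> 'p set set" assume U: "\<forall>n. U n \<subseteq> carrier ?B"
  let ?F = "{f :: nat \<Rightarrow> 'p set. \<forall>n. f n \<in> U n}"
  have reg: "regular_open P leq V" if "V \<in> U n" for V n
    using U that by (auto simp: boolean_completion_def)
  have reg_sub: "V \<subseteq> P" if "V \<in> U n" for V n
    using reg[OF that] by (simp add: regular_open_def)
  have reg_down: "q \<in> V" if "V \<in> U n" "p \<in> V" "q \<in> P" "leq q p" for V n p q
    using reg[OF that(1)] that(2-) unfolding regular_open_def by blast
  have sup: "\<Squnion>\<^bsub>?B\<^esub>(U n) = int_closure P leq (\<Union>(U n))" for n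
    using U by (simp add: boolean_completion_sup)
  have "regular_open P leq (int_closure P leq (\<Union>(U n)))" for n
    using reg_sub by (intro regular_open_int_closure Union_least)
  then have sup_closed: "range (\<lambda>n. \<Squnion>\<^bsub>?B\<^esub>(U n)) \<subseteq> carrier ?B"
    unfolding sup by (auto simp: boolean_completion_def)
  have lhs: "\<Sqinter>\<^bsub>?B\<^esub>(range (\<lambda>n. \<Squnion>\<^bsub>?B\<^esub>(U n))) = (\<Inter>n. int_closure P leq (\<Union>(U n)))"
    unfolding boolean_completion_inf[OF sup_closed] unfolding sup by (auto simp: int_closure_def)
  have Inter_sub: "P \<inter> \<Inter>(range f) = (\<Inter>n. f n)" if "f \<in> ?F" for f :: "nat \<Rightarrow> 'p set"
    using that reg_sub[of "f 0" 0] by auto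
  have inf: "\<Sqinter>\<^bsub>?B\<^esub>(range f) = (\<Inter>n. f n)" if "f \<in> ?F" for f
  proof -
    have "range f \<subseteq> carrier ?B" using U that by blast
    then show ?thesis
      using Inter_sub[OF that] by (simp only: boolean_completion_inf)
  qed
  have reg_Inter: "regular_open P leq (\<Inter>n. f n)" if "f \<in> ?F" for f
  proof -
    have "regular_open P leq V" if "V \<in> range f" for V
      using that \<open>f \<in> ?F\<close> reg by blast
    then have "regular_open P leq (P \<inter> \<Inter>(range f))"
      by (rule regular_open_Inter) (auto intro: leq_refl)
    then show ?thesis
      by (simp only: Inter_sub[OF that])
  qed
  have infs: "{\<Sqinter>\<^bsub>?B\<^esub>(range f) | f. \<forall>n. f n \<in> U n} = (\<lambda>f. \<Inter>n. f n) ` ?F"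
    unfolding setcompr_eq_image by (rule image_cong[OF refl inf])
  have infs_closed: "(\<lambda>f. \<Inter>n. f n) ` ?F \<subseteq> carrier ?B"
    using reg_Inter by (auto simp: boolean_completion_def)
  have rhs: "\<Squnion>\<^bsub>?B\<^esub>{\<Sqinter>\<^bsub>?B\<^esub>(range f) | f. \<forall>n. f n \<in> U n}
      = int_closure P leq (\<Union>f\<in>?F. \<Inter>n. f n)"
    unfolding infs by (rule boolean_completion_sup[OF infs_closed])
  show "\<Sqinter>\<^bsub>?B\<^esub>(range (\<lambda>n. \<Squnion>\<^bsub>?B\<^esub>(U n))) = \<Squnion>\<^bsub>?B\<^esub>{\<Sqinter>\<^bsub>?B\<^esub>(range f) | f. \<forall>n. f n \<in> U n}"
    unfolding lhs rhs
  proof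
    show "int_closure P leq (\<Union>f\<in>?F. \<Inter>n. f n) \<subseteq> (\<Inter>n. int_closure P leq (\<Union>(U n)))"
    proof (rule INT_greatest)
      fix n
      show "int_closure P leq (\<Union>f\<in>?F. \<Inter>n. f n) \<subseteq> int_closure P leq (\<Union>(U n))"
        by (rule int_closure_mono) auto
    qed
    show "(\<Inter>n. int_closure P leq (\<Union>(U n))) \<subseteq> int_closure P leq (\<Union>f\<in>?F. \<Inter>n. f n)"
    proof
      fix p assume p: "p \<in> (\<Inter>n. int_closure P leq (\<Union>(U n)))"
      then have "p \<in> P" by (auto simp: int_closure_def)
      have "\<exists>r\<in>(\<Union>f\<in>?F. \<Inter>n. f n). leq r q" if q: "q \<in> P" "leq q p" for q
      proof -
        let ?Q = "{r \<in> P. leq r p}"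
        have "\<exists>r'\<in>?Q. leq r' r \<and> r' \<in> \<Union>(U n)" if r: "r \<in> ?Q" for n r
        proof -
          obtain r' where r': "r' \<in> \<Union>(U n)" "leq r' r"
            using p r unfolding int_closure_def by blast
          then have "r' \<in> P" using reg_sub[of _ n] by blast
          moreover have "leq r' p"
            using leq_trans[of r' r p] r r' \<open>r' \<in> P\<close> \<open>p \<in> P\<close> by simp
          ultimately show ?thesis using r' by blast
        qed
        moreover have "?Q \<subseteq> P" "q \<in> ?Q"
          using q by auto
        ultimately have "\<exists>r\<in>P. leq r q \<and> (\<forall>n. \<exists>r'\<in>?Q. r' \<in> \<Union>(U n) \<and> leq r r')"
          by (intro meet_requirements[of ?Q q "\<lambda>n r'. r' \<in> \<Union>(U n)"])
        then obtain r where r: "r \<in> P" "leq r q" and meets: "\<And>n. \<exists>r'\<in>?Q. r' \<in> \<Union>(U n) \<and> leq r r'"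
          by blast
        have "\<exists>V. V \<in> U n \<and> r \<in> V" for n
        proof -
          obtain r' V where "V \<in> U n" "r' \<in> V" "leq r r'"
            using meets[of n] by blast
          then show ?thesis
            using reg_down r(1) by blast
        qed
        then obtain f where "\<And>n. f n \<in> U n \<and> r \<in> f n" by metis
        then have "f \<in> ?F" "r \<in> (\<Inter>n. f n)" by auto
        then show ?thesis using r by blast
      qed
      then show "p \<in> int_closure P leq (\<Union>f\<in>?F. \<Inter>n. f n)"
        using \<open>p \<in> P\<close> by (simp add: int_closure_def)
    qed
  qed
qed

end

subsection \<open>Properness\<close>

text \<open>
  The bound variable has index 7, which must differ from the indices substituted for the
  parameters. The body is a biconditional and a disjunction written with \<open>Neg\<close> and \<open>Conj\<close>.
\<close>

definition upair_fm :: "nat \<Rightarrow> nat \<Rightarrow> nat \<Rightarrow> fm" where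
  "upair_fm i j k =
     Neg (Ex 7 (Neg (Conj (Neg (Conj (Mem 7 i) (Conj (Neg (Eql 7 j)) (Neg (Eql 7 k)))))
                          (Neg (Conj (Neg (Mem 7 i)) (Neg (Conj (Neg (Eql 7 j)) (Neg (Eql 7 k)))))))))"

lemma sat_upair_fm:
  "\<lbrakk>i \<noteq> 7; j \<noteq> 7; k \<noteq> 7\<rbrakk> \<Longrightarrow> sat E UNIV v (upair_fm i j k) \<longleftrightarrow> is_upair E (v i) (v j) (v k)"
  unfolding upair_fm_def is_upair_def by auto

text \<open>
  With a condition \<open>p\<close> as variable 1, a dense set as variable 2 and the order as variable 3, the
  witnesses for variable 0 are the members of the dense set that extend \<open>p\<close>. Variables 4, 5
  and 6 are the Kuratowski pair and its two components.
\<close>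

definition extension_in_fm :: fm where
  "extension_in_fm =
     Conj (Mem 0 2) (Ex 4 (Conj (Mem 4 3) (Ex 5 (Ex 6
       (Conj (upair_fm 5 0 0) (Conj (upair_fm 6 0 1) (upair_fm 4 5 6)))))))"

lemma sat_extension_in_fm:
  "sat E UNIV v extension_in_fm \<longleftrightarrow> E (v 0) (v 2) \<and> (\<exists>z. E z (v 3) \<and> is_opair E z (v 0) (v 1))"
  unfolding extension_in_fm_def is_opair_def by (simp add: sat_upair_fm)

lemma elementary_submodel_witness:
  assumes M: "elementary_submodel E M" and v: "\<And>n. v n \<in> M" and "sat E UNIV v (Ex i \<phi>)"
  shows "\<exists>x\<in>M. sat E UNIV (v(i := x)) \<phi>"
proof -
  have "sat E M v (Ex i \<phi>)"
    using assms unfolding elementary_submodel_def by blast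
  then obtain x where x: "x \<in> M" "sat E M (v(i := x)) \<phi>"
    by auto
  moreover have "\<forall>n. (v(i := x)) n \<in> M"
    using v x(1) by simp
  ultimately show ?thesis
    using M unfolding elementary_submodel_def by blast
qed

lemma is_H_upair:
  assumes "is_H \<theta> E"
  shows "\<exists>u. is_upair E u x y"
proof -
  have "|{x, y}| <o natLeq"
    using finite_iff_ordLess_natLeq by blast
  then have "|{x, y}| <o \<theta>"
    using assms ordLess_transitive unfolding is_H_def by blast
  then obtain u where "{x, y} = {z. E z u}"
    using assms unfolding is_H_def by metis
  then show ?thesis
    unfolding is_upair_def by blast
qed

lemma is_H_opair:
  assumes "is_H \<theta> E"
  shows "\<exists>z. is_opair E z x y"
  using is_H_upair[OF assms] unfolding is_opair_def by metis

lemma is_upair_determines: "is_upair E u x y \<Longrightarrow> is_upair E u x' y' \<Longrightarrow> {x, y} = {x', y'}"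
  unfolding is_upair_def by auto

lemma is_opair_determines:
  assumes "is_opair E z x y" "is_opair E z x' y'"
  shows "x = x' \<and> y = y'"
proof -
  obtain u w where 1: "is_upair E u x x" "is_upair E w x y" "is_upair E z u w"
    using assms(1) unfolding is_opair_def by blast
  obtain u' w' where 2: "is_upair E u' x' x'" "is_upair E w' x' y'" "is_upair E z u' w'"
    using assms(2) unfolding is_opair_def by blast
  have "{u, w} = {u', w'}" using 1 2 is_upair_determines by metis
  then have "u = u' \<and> w = w' \<or> u = w' \<and> w = u'" by (auto simp: doubleton_eq_iff)
  then show ?thesis
    using 1 2 is_upair_determines by (metis doubleton_eq_iff)
qed

text \<open>
  That some member of \<open>D\<close> extends \<open>p\<close> is a first-order statement about the parameters \<open>c p\<close>, \<open>d\<close>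
  and \<open>b\<close>, all in \<open>M\<close>, so elementarity puts a witness into \<open>M\<close>; injectivity of the coding turns it
  back into a condition below \<open>p\<close>.
\<close>

lemma dense_extension_in_submodel:
  assumes H: "is_H \<theta> E" and code: "codes_forcing E P leq c a b"
    and M: "elementary_submodel E M" "b \<in> M"
    and D: "dense_in P leq D" "d \<in> M" "{z. E z d} = c ` D"
    and p: "p \<in> P" "c p \<in> M"
  shows "\<exists>r\<in>D. c r \<in> M \<and> leq r p"
proof -
  have b: "E z b \<longleftrightarrow> (\<exists>p\<in>P. \<exists>q\<in>P. leq p q \<and> is_opair E z (c p) (c q))" for z
    using code unfolding codes_forcing_def by blast
  have inj: "inj_on c P"
    using code unfolding codes_forcing_def by blast
  have "D \<subseteq> P" using D(1) by (simp add: dense_in_def)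
  define v where "v = (\<lambda>_ :: nat. c p)(2 := d, 3 := b)"
  have v: "v n \<in> M" for n
    using p(2) D(2) M(2) by (simp add: v_def)
  obtain r where r: "r \<in> D" "leq r p"
    using D(1) p(1) unfolding dense_in_def by blast
  obtain z where "is_opair E z (c r) (c p)"
    using is_H_opair[OF H] by blast
  then have "E z b"
    using b r p \<open>D \<subseteq> P\<close> by blast
  then have "sat E UNIV (v(0 := c r)) extension_in_fm"
    using D(3) r \<open>is_opair E z (c r) (c p)\<close> by (auto simp: sat_extension_in_fm v_def)
  then obtain x where x: "x \<in> M" "sat E UNIV (v(0 := x)) extension_in_fm"
    using elementary_submodel_witness[of E M v 0 extension_in_fm] M(1) v by auto
  then obtain z' where z': "E x d" "E z' b" "is_opair E z' x (c p)"
    by (auto simp: sat_extension_in_fm v_def)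
  then obtain s where s: "s \<in> D" "x = c s"
    using D(3) by blast
  obtain p1 q1 where pq: "p1 \<in> P" "q1 \<in> P" "leq p1 q1" "is_opair E z' (c p1) (c q1)"
    using z'(2) b by blast
  then have "c s = c p1" "c p = c q1"
    using is_opair_determines[OF z'(3)] s by auto
  then have "leq s p"
    using inj pq p s \<open>D \<subseteq> P\<close> by (metis inj_onD subsetD)
  then show ?thesis using s x by blast
qed

context sigma_closed_forcing
begin

text \<open>
  Enumerate \<open>M\<close> in type \<open>\<omega>\<close> and descend inside \<open>M\<close> through every dense set coded in it. The lower
  bound is below a member of \<open>D \<inter> M\<close> for each such \<open>D\<close>, which is stronger than predensity of
  \<open>D \<inter> M\<close> below it.
\<close>

theorem sigma_closed_proper: "proper_forcing TYPE('u) P leq"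
  unfolding proper_forcing_def
proof (intro allI impI ballI, elim conjE)
  fix \<theta> :: "'u rel" and E c a b M p
  assume H: "is_H \<theta> E" and code: "codes_forcing E P leq c a b"
    and M: "countable M" "elementary_submodel E M" "b \<in> M" and p: "p \<in> P" "c p \<in> M"
  let ?Q = "{p \<in> P. c p \<in> M}"
  \<comment> \<open>vacuous if the \<open>n\<close>-th element of \<open>M\<close> does not code a dense set\<close>
  define R where "R n r \<longleftrightarrow>
      (\<forall>D. dense_in P leq D \<and> {z. E z (from_nat_into M n)} = c ` D \<longrightarrow> r \<in> D)" for n r
  have inj: "inj_on c P"
    using code unfolding codes_forcing_def by blast
  have "\<exists>r\<in>?Q. leq r q \<and> R n r" if q: "q \<in> ?Q" for n q
  proof (cases "\<exists>D. dense_in P leq D \<and> {z. E z (from_nat_into M n)} = c ` D")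
    case True
    then obtain D where D: "dense_in P leq D" "{z. E z (from_nat_into M n)} = c ` D" by blast
    have "from_nat_into M n \<in> M"
      using M(2) by (intro from_nat_into) (simp add: elementary_submodel_def)
    then obtain r where r: "r \<in> D" "c r \<in> M" "leq r q"
      using dense_extension_in_submodel[OF H code M(2,3) D(1) _ D(2)] q by blast
    have "D' = D" if "dense_in P leq D'" "{z. E z (from_nat_into M n)} = c ` D'" for D'
      using that D inj inj_on_image_eq_iff[of c P D' D] by (auto simp: dense_in_def)
    then have "R n r" using r by (auto simp: R_def)
    then show ?thesis using r D by (auto simp: dense_in_def)
  next
    case False
    then have "R n q" unfolding R_def by blast
    then show ?thesis using q leq_refl by blast
  qed
  then obtain q where q: "q \<in> P" "leq q p" and meets: "\<And>n. \<exists>r\<in>?Q. R n r \<and> leq q r"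
    using meet_requirements[of ?Q p R] p by blast
  have "M_generic E M P leq c q"
    unfolding M_generic_def predense_below_def
  proof (intro allI impI ballI, elim conjE)
    fix D d r
    assume D: "dense_in P leq D" "d \<in> M" "{z. E z d} = c ` D" and r: "r \<in> P" "leq r q"
    obtain n where "from_nat_into M n = d"
      using from_nat_into_surj[OF M(1) D(2)] by blast
    then obtain s where s: "s \<in> D" "s \<in> ?Q" "leq q s"
      using meets[of n] D unfolding R_def by blast
    then have "compatible P leq r s"
      using r q leq_refl leq_trans unfolding compatible_def by blast
    then show "\<exists>s\<in>{p \<in> D. c p \<in> M}. compatible P leq r s" using s by blast
  qed
  with q show "\<exists>q\<in>P. leq q p \<and> M_generic E M P leq c q" by blast
qed

end

section \<open>The quotient forcing of the ideal\<close>

theorem theorem8p5: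
  fixes A :: "nat list \<Rightarrow> nat set"
  assumes "tree_partition A"
  shows "sigma_closed (H_plus A) (le_H A) \<and>
         proper_forcing TYPE('u) (H_plus A) (le_H A) \<and>
         omega_distributive (boolean_completion (H_plus A) (le_H A)) \<and>
         adds_no_reals (H_plus A) (le_H A)"
proof -
  interpret sigma_closed_forcing "H_plus A" "le_H A"
  proof
    show "sigma_closed (H_plus A) (le_H A)"
      using le_H_lower_bound[OF assms] unfolding sigma_closed_def by blast
  qed (use le_H_refl le_H_trans[OF assms] in blast)+
  show ?thesis
    using sigma_closed sigma_closed_proper sigma_closed_omega_distributive sigma_closed_adds_no_reals
    by blast
qed

end
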